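(* Let $(M;\le_1,\ldots,\le_n)$ be a countable structure homogeneous in the language $\{\le_1,\ldots,\le_n\}$, where each $\le_i$ is a linear order, such that no two orders $\le_i,\le_j$ ($i\ne j$) are equal or opposite of each other. Assume each $(M,\le_i)$ is topologically primitive. Then $M$ is the Fraïssé limit of the class of finite sets equipped with $n$ linear orders.
   Context: Homogeneous: every isomorphism between finite substructures extends to an automorphism. $(M,\le_i)$ is topologically primitive if there is no nontrivial $\emptyset$-definable (in $M$) equivalence relation on $M$ whose classes are convex for $\le_i$ (nontrivial: more than one class and not equality).
   Formalization: "Countable" is taken as countably infinite: for finite M the claim is false (for instance a one-point M with n = 1 meets all hypotheses but does not contain a two-element chain). *)

theory Defs
  imports "HOL-Library.Countable_Set"
begin

text \<open>
  A structure in the language of \<open>n\<close> binary relation symbols consists of a carrier set and a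
  family of relations, of which only the members indexed by \<open>{1..n}\<close> matter. Since the language
  is relational, the substructures of a structure are given by the subsets of its carrier;
  \<open>embedding\<close> and \<open>isomorphism\<close> inspect the relations on their first carrier only, so they can be
  applied to induced substructures without restricting the relations explicitly.
\<close>

definition embedding ::
    "nat \<Rightarrow> 'a set \<Rightarrow> (nat \<Rightarrow> 'a rel) \<Rightarrow> 'b set \<Rightarrow> (nat \<Rightarrow> 'b rel) \<Rightarrow> ('a \<Rightarrow> 'b) \<Rightarrow> bool" where
  "embedding n A R B S f \<longleftrightarrow>
     f ` A \<subseteq> B \<and> inj_on f A \<and>
     (\<forall>i\<in>{1..n}. \<forall>x\<in>A. \<forall>y\<in>A. (x, y) \<in> R i \<longleftrightarrow> (f x, f y) \<in> S i)"

definition isomorphism ::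
    "nat \<Rightarrow> 'a set \<Rightarrow> (nat \<Rightarrow> 'a rel) \<Rightarrow> 'b set \<Rightarrow> (nat \<Rightarrow> 'b rel) \<Rightarrow> ('a \<Rightarrow> 'b) \<Rightarrow> bool" where
  "isomorphism n A R B S f \<longleftrightarrow> embedding n A R B S f \<and> f ` A = B"

definition automorphism :: "nat \<Rightarrow> 'a set \<Rightarrow> (nat \<Rightarrow> 'a rel) \<Rightarrow> ('a \<Rightarrow> 'a) \<Rightarrow> bool" where
  "automorphism n M R f \<longleftrightarrow> isomorphism n M R M R f"

definition homogeneous :: "nat \<Rightarrow> 'a set \<Rightarrow> (nat \<Rightarrow> 'a rel) \<Rightarrow> bool" where
  "homogeneous n M R \<longleftrightarrow>
     (\<forall>A B f. A \<subseteq> M \<and> B \<subseteq> M \<and> finite A \<and> finite B \<and> isomorphism n A R B R f \<longrightarrow>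
        (\<exists>g. automorphism n M R g \<and> (\<forall>x\<in>A. g x = f x)))"

text \<open>First-order formulas with equality; variables and relation symbols are natural numbers.\<close>

datatype fm =
    EqF nat nat
  | RelF nat nat nat
  | NegF fm
  | ConjF fm fm
  | ExF nat fm

primrec sat :: "'a set \<Rightarrow> (nat \<Rightarrow> 'a rel) \<Rightarrow> (nat \<Rightarrow> 'a) \<Rightarrow> fm \<Rightarrow> bool" where
  "sat M R v (EqF x y) \<longleftrightarrow> v x = v y"
| "sat M R v (RelF i x y) \<longleftrightarrow> (v x, v y) \<in> R i"
| "sat M R v (NegF p) \<longleftrightarrow> \<not> sat M R v p"
| "sat M R v (ConjF p q) \<longleftrightarrow> sat M R v p \<and> sat M R v q"
| "sat M R v (ExF x p) \<longleftrightarrow> (\<exists>a\<in>M. sat M R (v(x := a)) p)"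

primrec free_vars :: "fm \<Rightarrow> nat set" where
  "free_vars (EqF x y) = {x, y}"
| "free_vars (RelF i x y) = {x, y}"
| "free_vars (NegF p) = free_vars p"
| "free_vars (ConjF p q) = free_vars p \<union> free_vars q"
| "free_vars (ExF x p) = free_vars p - {x}"

primrec rel_symbols :: "fm \<Rightarrow> nat set" where
  "rel_symbols (EqF x y) = {}"
| "rel_symbols (RelF i x y) = {i}"
| "rel_symbols (NegF p) = rel_symbols p"
| "rel_symbols (ConjF p q) = rel_symbols p \<union> rel_symbols q"
| "rel_symbols (ExF x p) = rel_symbols p"

text \<open>Definability without parameters; the variables 0 and 1 hold the two arguments.\<close>

definition definable_rel :: "nat \<Rightarrow> 'a set \<Rightarrow> (nat \<Rightarrow> 'a rel) \<Rightarrow> 'a rel \<Rightarrow> bool" where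
  "definable_rel n M R E \<longleftrightarrow>
     (\<exists>p. rel_symbols p \<subseteq> {1..n} \<and> free_vars p \<subseteq> {0, 1} \<and>
          E = {(a, b) \<in> M \<times> M. sat M R (\<lambda>k. if k = 0 then a else b) p})"

definition convex_in :: "'a set \<Rightarrow> 'a rel \<Rightarrow> 'a set \<Rightarrow> bool" where
  "convex_in M r C \<longleftrightarrow>
     (\<forall>x\<in>C. \<forall>y\<in>C. \<forall>z\<in>M. (x, z) \<in> r \<and> (z, y) \<in> r \<longrightarrow> z \<in> C)"

text \<open>
  Definability refers to the full structure with all \<open>n\<close> relations, convexity to the \<open>i\<close>-th only.
\<close>

definition topologically_primitive :: "nat \<Rightarrow> 'a set \<Rightarrow> (nat \<Rightarrow> 'a rel) \<Rightarrow> nat \<Rightarrow> bool" where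
  "topologically_primitive n M R i \<longleftrightarrow>
     \<not> (\<exists>E. equiv M E \<and> definable_rel n M R E \<and>
            (\<forall>C \<in> M // E. convex_in M (R i) C) \<and>
            (\<exists>C \<in> M // E. \<exists>D \<in> M // E. C \<noteq> D) \<and> E \<noteq> Id_on M)"

text \<open>
  Classes of finite structures are represented by their members whose carrier is a finite set of
  natural numbers; every finite structure is isomorphic to one of these.
\<close>

definition age :: "nat \<Rightarrow> 'a set \<Rightarrow> (nat \<Rightarrow> 'a rel) \<Rightarrow> (nat set \<times> (nat \<Rightarrow> nat rel)) set" where
  "age n M R =
     {(A, S). finite A \<and> (\<forall>i\<in>{1..n}. S i \<subseteq> A \<times> A) \<and> (\<exists>f. embedding n A S M R f)}"

definition fraisse_limit ::
    "nat \<Rightarrow> 'a set \<Rightarrow> (nat \<Rightarrow> 'a rel) \<Rightarrow> (nat set \<times> (nat \<Rightarrow> nat rel)) set \<Rightarrow> bool" where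
  "fraisse_limit n M R K \<longleftrightarrow> countable M \<and> homogeneous n M R \<and> age n M R = K"

definition finite_multiorders :: "nat \<Rightarrow> (nat set \<times> (nat \<Rightarrow> nat rel)) set" where
  "finite_multiorders n = {(A, S). finite A \<and> (\<forall>i\<in>{1..n}. linear_order_on A (S i))}"

end

theory Submission
  imports Defs
begin

text \<open>
  Write \<open>x \<lless> y\<close> if \<open>x\<close> is below \<open>y\<close> in every order. After reversing some of the orders, \<open>\<lless>\<close> is
  directed in both directions: a finite set containing all isomorphism types of pairs has two
  copies that are separated in every order, and the signs are read off from these copies. By
  homogeneity \<open>\<lless>\<close> is dense, and "no pair \<open>u \<lless> v\<close> lies in the \<open>j\<close>-interval between \<open>x\<close> and \<open>y\<close>" is a
  definable equivalence relation with convex classes. By primitivity it is equality, and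
  shifting a \<open>\<lless>\<close>-chain found in a \<open>j\<close>-interval yields elements that dominate \<open>x\<close> and are arbitrarily
  close to \<open>x\<close> in the \<open>j\<close>-th order.

  Homogeneity makes all \<open>\<lless>\<close>-chains of the same length conjugate, so the positions which the \<open>n\<close>
  coordinates of a point can take relative to a chain do not depend on the chain. As the orders
  are pairwise distinct, any two coordinates can be separated by a chain, and measuring points
  against chains formed by other points shows that all position vectors occur. Finally, an arbitrary
  finite multiorder embeds by realising the ranks of its elements as positions over one chain.
\<close>

section \<open>Reversing some of the orders\<close>

text \<open>Homogeneity, convexity, primitivity and embeddability survive the reversal of individual
  orders, so the signs \<open>s\<close> may be chosen freely; \<open>s i\<close> true means that
  order \<open>i\<close> is kept.\<close>

definition flip :: "(nat \<Rightarrow> bool) \<Rightarrow> (nat \<Rightarrow> 'a rel) \<Rightarrow> nat \<Rightarrow> 'a rel" where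
  "flip s R i = (if s i then R i else (R i)\<inverse>)"

lemma linear_order_on_flip [simp]: "linear_order_on A (flip s R i) = linear_order_on A (R i)"
  by (simp add: flip_def)

lemma embedding_flip [simp]:
  "embedding n A (flip s R) B (flip s S) f \<longleftrightarrow> embedding n A R B S f"
proof -
  have "(\<forall>x\<in>A. \<forall>y\<in>A. (x, y) \<in> flip s R i \<longleftrightarrow> (f x, f y) \<in> flip s S i) \<longleftrightarrow>
      (\<forall>x\<in>A. \<forall>y\<in>A. (x, y) \<in> R i \<longleftrightarrow> (f x, f y) \<in> S i)" for i
    by (cases "s i") (simp add: flip_def, simp add: flip_def, blast)
  then show ?thesis by (simp add: embedding_def)
qed

lemma automorphism_flip [simp]: "automorphism n M (flip s R) f \<longleftrightarrow> automorphism n M R f"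
  by (simp add: automorphism_def isomorphism_def)

lemma homogeneous_flip [simp]: "homogeneous n M (flip s R) \<longleftrightarrow> homogeneous n M R"
  by (simp add: homogeneous_def isomorphism_def)

primrec flip_fm :: "(nat \<Rightarrow> bool) \<Rightarrow> fm \<Rightarrow> fm" where
  "flip_fm s (EqF x y) = EqF x y"
| "flip_fm s (RelF i x y) = (if s i then RelF i x y else RelF i y x)"
| "flip_fm s (NegF p) = NegF (flip_fm s p)"
| "flip_fm s (ConjF p q) = ConjF (flip_fm s p) (flip_fm s q)"
| "flip_fm s (ExF x p) = ExF x (flip_fm s p)"

lemma sat_flip_fm: "sat M R v (flip_fm s p) \<longleftrightarrow> sat M (flip s R) v p"
  by (induction p arbitrary: v) (auto simp: flip_def)

lemma symbols_flip_fm [simp]: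
  "free_vars (flip_fm s p) = free_vars p" "rel_symbols (flip_fm s p) = rel_symbols p"
  by (induction p) auto

lemma definable_rel_flip:
  assumes "definable_rel n M (flip s R) E"
  shows "definable_rel n M R E"
proof -
  obtain p where "rel_symbols p \<subseteq> {1..n}" "free_vars p \<subseteq> {0, 1}"
    and "E = {(a, b) \<in> M \<times> M. sat M (flip s R) (\<lambda>k. if k = 0 then a else b) p}"
    using assms unfolding definable_rel_def by blast
  then show ?thesis
    unfolding definable_rel_def by (intro exI[of _ "flip_fm s p"]) (simp add: sat_flip_fm)
qed

lemma convex_in_flip [simp]: "convex_in M (flip s R i) C \<longleftrightarrow> convex_in M (R i) C"
  unfolding convex_in_def flip_def by auto

lemma topologically_primitive_flip:
  assumes "topologically_primitive n M R i"
  shows "topologically_primitive n M (flip s R) i"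
  using assms definable_rel_flip[of n M s R] unfolding topologically_primitive_def convex_in_flip
  by meson

section \<open>Homogeneous families of linear orders\<close>

text \<open>For \<open>n = 0\<close> dominance would hold vacuously between any two points of
  \<open>M\<close>, even between a point and itself; that case is split off in the main
  theorem.\<close>

locale homogeneous_orders =
  fixes n :: nat and M :: "'a set" and R :: "nat \<Rightarrow> 'a rel"
  assumes linear: "i \<in> {1..n} \<Longrightarrow> linear_order_on M (R i)"
    and homogeneous: "homogeneous n M R"
    and infinite_carrier: "infinite M"
    and pos: "0 < n"
begin

definition lt :: "nat \<Rightarrow> 'a \<Rightarrow> 'a \<Rightarrow> bool" where
  "lt i x y \<longleftrightarrow> (x, y) \<in> R i \<and> x \<noteq> y"

definition dominated :: "'a \<Rightarrow> 'a \<Rightarrow> bool" (infix \<open>\<lless>\<close> 50) where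
  "x \<lless> y \<longleftrightarrow> x \<in> M \<and> y \<in> M \<and> (\<forall>i\<in>{1..n}. lt i x y)"

lemma lt_carrier: "i \<in> {1..n} \<Longrightarrow> lt i x y \<Longrightarrow> x \<in> M \<and> y \<in> M"
  using linear[of i] by (auto simp: lt_def order_on_defs)

lemma lt_trans: "i \<in> {1..n} \<Longrightarrow> lt i x y \<Longrightarrow> lt i y z \<Longrightarrow> lt i x z"
  using linear[of i] unfolding lt_def order_on_defs by (meson antisymD transD)

lemma lt_asym: "i \<in> {1..n} \<Longrightarrow> lt i x y \<Longrightarrow> \<not> lt i y x"
  using linear[of i] unfolding lt_def order_on_defs by (meson antisymD)

lemma lt_irrefl [simp]: "\<not> lt i x x"
  by (simp add: lt_def)

lemma lt_total: "i \<in> {1..n} \<Longrightarrow> x \<in> M \<Longrightarrow> y \<in> M \<Longrightarrow> lt i x y \<or> x = y \<or> lt i y x"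
  using linear[of i] unfolding lt_def order_on_defs total_on_def by blast

lemma rel_iff_lt: "i \<in> {1..n} \<Longrightarrow> (x, y) \<in> R i \<longleftrightarrow> lt i x y \<or> x = y \<and> x \<in> M"
  using linear[of i] by (auto simp: lt_def order_on_defs refl_on_def)

lemma rel_iff_not_lt:
  "i \<in> {1..n} \<Longrightarrow> x \<in> M \<Longrightarrow> y \<in> M \<Longrightarrow> (x, y) \<in> R i \<longleftrightarrow> \<not> lt i y x"
  using lt_total[of i x y] lt_asym[of i x y] by (auto simp: rel_iff_lt)

lemma dominatedD: "x \<lless> y \<Longrightarrow> i \<in> {1..n} \<Longrightarrow> lt i x y"
  by (simp add: dominated_def)

lemma dominated_carrier: "x \<lless> y \<Longrightarrow> x \<in> M \<and> y \<in> M"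
  by (simp add: dominated_def)

lemma automorphism_iff:
  "automorphism n M R g \<longleftrightarrow> bij_betw g M M \<and>
    (\<forall>i\<in>{1..n}. \<forall>x\<in>M. \<forall>y\<in>M. (x, y) \<in> R i \<longleftrightarrow> (g x, g y) \<in> R i)"
  unfolding automorphism_def isomorphism_def embedding_def bij_betw_def by blast

lemma automorphism_id: "automorphism n M R id"
  by (simp add: automorphism_iff)

lemma automorphism_closed: "automorphism n M R g \<Longrightarrow> x \<in> M \<Longrightarrow> g x \<in> M"
  unfolding automorphism_iff by (blast dest: bij_betwE)

lemma automorphism_comp:
  assumes "automorphism n M R g" "automorphism n M R h"
  shows "automorphism n M R (g \<circ> h)"
proof -
  have "bij_betw (g \<circ> h) M M"
    using assms unfolding automorphism_iff by (blast intro: bij_betw_trans)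
  then show ?thesis
    using assms automorphism_closed[OF assms(2)] unfolding automorphism_iff comp_apply by blast
qed

lemma automorphism_surj: "automorphism n M R g \<Longrightarrow> y \<in> M \<Longrightarrow> \<exists>x\<in>M. g x = y"
  unfolding automorphism_iff bij_betw_def by (metis imageE)

lemma automorphism_eq_iff:
  "automorphism n M R g \<Longrightarrow> x \<in> M \<Longrightarrow> y \<in> M \<Longrightarrow> g x = g y \<longleftrightarrow> x = y"
  unfolding automorphism_iff bij_betw_def by (meson inj_on_eq_iff)

lemma automorphism_lt:
  "automorphism n M R g \<Longrightarrow> i \<in> {1..n} \<Longrightarrow> x \<in> M \<Longrightarrow> y \<in> M \<Longrightarrow> lt i (g x) (g y) \<longleftrightarrow> lt i x y"
  unfolding lt_def using automorphism_eq_iff[of g x y] unfolding automorphism_iff by blast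

lemma automorphism_dominated:
  "automorphism n M R g \<Longrightarrow> x \<in> M \<Longrightarrow> y \<in> M \<Longrightarrow> g x \<lless> g y \<longleftrightarrow> x \<lless> y"
  by (simp add: dominated_def automorphism_closed automorphism_eq_iff automorphism_lt)

lemma dominated_trans: "x \<lless> y \<Longrightarrow> y \<lless> z \<Longrightarrow> x \<lless> z"
  unfolding dominated_def using lt_trans by blast

lemma dominated_neq: "x \<lless> y \<Longrightarrow> x \<noteq> y"
  using pos dominatedD[of x y 1] by auto

text \<open>Distinct points are strictly comparable, so a map preserving each strict order is
  automatically injective and reflects the orders. Homogeneity then applies to it.\<close>

lemma extend_embedding:
  assumes "finite A" "A \<subseteq> M" "f ` A \<subseteq> M"
    and lt: "\<And>i x y. i \<in> {1..n} \<Longrightarrow> x \<in> A \<Longrightarrow> y \<in> A \<Longrightarrow> lt i x y \<Longrightarrow> lt i (f x) (f y)"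
  shows "\<exists>g. automorphism n M R g \<and> (\<forall>x\<in>A. g x = f x)"
proof -
  have 1: "1 \<in> {1..n}" using pos by simp
  have inj: "inj_on f A"
  proof (rule inj_onI, rule ccontr)
    fix x y assume "x \<in> A" "y \<in> A" "f x = f y" "x \<noteq> y"
    then show False using lt_total[OF 1, of x y] lt[OF 1, of x y] lt[OF 1, of y x] assms(2) by auto
  qed
  have "(x, y) \<in> R i \<longleftrightarrow> (f x, f y) \<in> R i" if "i \<in> {1..n}" "x \<in> A" "y \<in> A" for i x y
  proof -
    have "x \<in> M" "y \<in> M" "f x \<in> M" "f y \<in> M" using that assms by auto
    then show ?thesis
      using that lt_total[of i x y] lt[of i x y] lt[of i y x] lt_asym[of i "f x" "f y"]
        lt_asym[of i x y] rel_iff_not_lt[of i x y] rel_iff_not_lt[of i "f x" "f y"]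
      by fastforce
  qed
  then have "isomorphism n A R (f ` A) R f"
    using inj by (simp add: isomorphism_def embedding_def)
  then show ?thesis
    using homogeneous assms unfolding homogeneous_def by blast
qed

section \<open>Copies of a finite set that are separated in every order\<close>

lemma transitive:
  assumes "a \<in> M" "b \<in> M"
  shows "\<exists>g. automorphism n M R g \<and> g a = b"
  using extend_embedding[of "{a}" "\<lambda>_. b"] assms by auto

lemma exists_greater:
  assumes "i \<in> {1..n}" "a \<in> M"
  shows "\<exists>b. lt i a b"
proof -
  obtain c d where cd: "lt i c d"
  proof -
    obtain c where "c \<in> M - {a}"
      using infinite_carrier by (metis ex_in_conv finite.emptyI infinite_remove)
    then show ?thesis using that lt_total[OF assms(1), of a c] assms(2) by blast
  qed
  then have "c \<in> M" "d \<in> M" using lt_carrier assms by auto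
  with transitive[of c a] obtain g where "automorphism n M R g" "g c = a" using assms by blast
  then show ?thesis using automorphism_lt[of g i c d] cd assms \<open>c \<in> M\<close> \<open>d \<in> M\<close> by metis
qed

text \<open>Let \<open>m\<close> be the least and \<open>u\<close> the greatest element of
  \<open>F\<close> in order \<open>i\<close>. An automorphism taking \<open>m\<close> above
  \<open>u\<close> lifts all of \<open>F\<close> above \<open>F\<close>.\<close>

lemma shifted_copy:
  assumes i: "i \<in> {1..n}" and F: "finite F" "F \<subseteq> M"
  shows "\<exists>r. automorphism n M R r \<and> (\<forall>x\<in>F. \<forall>y\<in>F. lt i x (r y))"
proof (cases "F = {}")
  case True
  then show ?thesis using automorphism_id by blast
next
  case False
  have asym: "asymp_on F (lt i)" by (rule asymp_onI) (rule lt_asym[OF i])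
  have trans: "transp_on F (lt i)" by (rule transp_onI) (rule lt_trans[OF i])
  have "\<exists>m\<in>F. \<forall>x\<in>F. \<not> lt i x m"
    using Finite_Set.bex_min_element[OF F(1) asym trans False] lt_irrefl by metis
  moreover have "\<exists>m\<in>F. \<forall>x\<in>F. \<not> lt i m x"
    using Finite_Set.bex_max_element[OF F(1) asym trans False] lt_irrefl by metis
  ultimately obtain m u where m: "m \<in> F" "\<And>x. x \<in> F \<Longrightarrow> \<not> lt i x m"
    and u: "u \<in> F" "\<And>x. x \<in> F \<Longrightarrow> \<not> lt i u x" by blast
  obtain v where v: "lt i u v" using exists_greater i u F by blast
  then have "v \<in> M" "m \<in> M" using lt_carrier i m F by auto
  then obtain r where r: "automorphism n M R r" "r m = v" using transitive by blast
  have "lt i x (r y)" if "x \<in> F" "y \<in> F" for x y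
  proof -
    have "x \<in> M" "y \<in> M" "u \<in> M" using that F u by auto
    then have "lt i x u \<or> x = u" "lt i m y \<or> m = y"
      using lt_total[OF i, of x u] lt_total[OF i, of m y] m u that \<open>m \<in> M\<close> by auto
    then have "lt i x v" "lt i v (r y) \<or> v = r y"
      using v lt_trans[OF i, of x u v] automorphism_lt[OF r(1) i, of m y] r \<open>m \<in> M\<close> \<open>y \<in> M\<close> by auto
    then show ?thesis using lt_trans[OF i, of x v "r y"] by auto
  qed
  with r show ?thesis by blast
qed

text \<open>Induction on the number of orders treated. The induction hypothesis is applied to
  \<open>F\<close> together with a copy of \<open>F\<close> lying above it in the new order; this
  leaves enough room to choose which of the two parts to use on either side.\<close>

lemma separated_copies:
  assumes "finite F" "F \<subseteq> M" "k \<le> n"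
  shows "\<exists>g h. automorphism n M R g \<and> automorphism n M R h \<and>
    (\<forall>i\<in>{1..k}. (\<forall>x\<in>F. \<forall>y\<in>F. lt i (g x) (h y)) \<or> (\<forall>x\<in>F. \<forall>y\<in>F. lt i (h y) (g x)))"
  using assms
proof (induction k arbitrary: F)
  case 0
  then show ?case using automorphism_id by auto
next
  case (Suc k)
  let ?i = "Suc k"
  have i: "?i \<in> {1..n}" using Suc.prems by simp
  obtain r where r: "automorphism n M R r" "\<And>x y. x \<in> F \<Longrightarrow> y \<in> F \<Longrightarrow> lt ?i x (r y)"
    using shifted_copy[OF i Suc.prems(1,2)] by blast
  have "finite (F \<union> r ` F)" "F \<union> r ` F \<subseteq> M"
    using Suc.prems automorphism_closed[OF r(1)] by auto
  with Suc.IH[of "F \<union> r ` F"] Suc.prems obtain g h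
    where g: "automorphism n M R g" and h: "automorphism n M R h"
      and sep: "\<And>i. i \<in> {1..k} \<Longrightarrow>
        (\<forall>x\<in>F \<union> r ` F. \<forall>y\<in>F \<union> r ` F. lt i (g x) (h y)) \<or>
        (\<forall>x\<in>F \<union> r ` F. \<forall>y\<in>F \<union> r ` F. lt i (h y) (g x))"
    by (metis Suc_leD)
  have FM: "x \<in> M" "r x \<in> M" "g x \<in> M" "h x \<in> M" "g (r x) \<in> M" "h (r x) \<in> M"
    if "x \<in> F" for x
    using that Suc.prems automorphism_closed[OF r(1)] automorphism_closed[OF g]
      automorphism_closed[OF h] by auto
  have sep1: "(\<forall>x\<in>F. \<forall>y\<in>F. lt i (g x) (h (r y))) \<or> (\<forall>x\<in>F. \<forall>y\<in>F. lt i (h (r y)) (g x))"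
    and sep2: "(\<forall>x\<in>F. \<forall>y\<in>F. lt i (g (r x)) (h y)) \<or> (\<forall>x\<in>F. \<forall>y\<in>F. lt i (h y) (g (r x)))"
    if "i \<in> {1..k}" for i
    using sep[OF that] by blast+
  show ?case
  proof (cases "\<forall>x\<in>F. \<forall>y\<in>F. lt ?i (g x) (h (r y))")
    case True
    then have "\<forall>i\<in>{1..Suc k}. (\<forall>x\<in>F. \<forall>y\<in>F. lt i (g x) ((h \<circ> r) y)) \<or>
        (\<forall>x\<in>F. \<forall>y\<in>F. lt i ((h \<circ> r) y) (g x))"
      using sep1 by (simp add: atLeastAtMostSuc_conv)
    then show ?thesis using g automorphism_comp[OF h r(1)] by blast
  next
    case False
    \<comment> \<open>One failure suffices: in the new order, \<open>h z\<close> is below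
      \<open>h (r y)\<close>, which is at most \<open>g x\<close>, which is below
      \<open>g (r w)\<close>. Hence \<open>h\<close> and \<open>g \<circ> r\<close> separate
      \<open>F\<close> there.\<close>
    then obtain x y where xy: "x \<in> F" "y \<in> F" "\<not> lt ?i (g x) (h (r y))" by blast
    have "lt ?i (h z) (g (r w))" if "z \<in> F" "w \<in> F" for z w
    proof -
      have "lt ?i (h z) (h (r y))"
        using automorphism_lt[OF h i, of z "r y"] r(2)[of z y] FM that xy by blast
      moreover have "lt ?i (g x) (g (r w))"
        using automorphism_lt[OF g i, of x "r w"] r(2)[of x w] FM that xy by blast
      moreover have "lt ?i (h (r y)) (g x) \<or> h (r y) = g x"
        using lt_total[OF i, of "g x" "h (r y)"] FM xy by auto
      ultimately show ?thesis using lt_trans[OF i] by metis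
    qed
    then have "\<forall>i\<in>{1..Suc k}. (\<forall>x\<in>F. \<forall>y\<in>F. lt i ((g \<circ> r) x) (h y)) \<or>
        (\<forall>x\<in>F. \<forall>y\<in>F. lt i (h y) ((g \<circ> r) x))"
      using sep2 by (simp add: atLeastAtMostSuc_conv)
    then show ?thesis using h automorphism_comp[OF g r(1)] by blast
  qed
qed

text \<open>Automorphisms have finitely many orbits on pairs, since by homogeneity the orbit of a
  pair is determined by the sets of orders in which it is increasing or decreasing. One
  representative is chosen per orbit.\<close>

lemma finite_pair_representatives:
  "\<exists>F. finite F \<and> F \<subseteq> M \<and>
    (\<forall>x\<in>M. \<forall>y\<in>M. \<exists>g. automorphism n M R g \<and> g x \<in> F \<and> g y \<in> F)"
proof -
  define key where "key = (\<lambda>(x, y). ({i\<in>{1..n}. lt i x y}, {i\<in>{1..n}. lt i y x}))"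
  let ?K = "key ` (M \<times> M)"
  have "?K \<subseteq> Pow {1..n} \<times> Pow {1..n}" by (auto simp: key_def)
  then have fin: "finite ?K" by (rule finite_subset) simp
  define rep where "rep = inv_into (M \<times> M) key"
  define F where "F = fst ` rep ` ?K \<union> snd ` rep ` ?K"
  have rep: "rep k \<in> M \<times> M" "key (rep k) = k" if "k \<in> ?K" for k
    using that unfolding rep_def by (auto intro: inv_into_into f_inv_into_f)
  have "finite F" using fin by (simp add: F_def)
  moreover have FM: "F \<subseteq> M" unfolding F_def using rep(1) by (fastforce simp: mem_Times_iff)
  moreover have "\<exists>g. automorphism n M R g \<and> g x \<in> F \<and> g y \<in> F" if "x \<in> M" "y \<in> M" for x y
  proof -
    let ?k = "key (x, y)"
    have k: "?k \<in> ?K" using that by blast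
    obtain x' y' where xy': "rep ?k = (x', y')" by fastforce
    with k have F: "x' \<in> F" "y' \<in> F" unfolding F_def by (force intro: image_eqI)+
    have "key (x', y') = key (x, y)" using rep(2)[OF k] xy' by simp
    then have lt: "lt i x y \<longleftrightarrow> lt i x' y'" "lt i y x \<longleftrightarrow> lt i y' x'" if "i \<in> {1..n}" for i
      using that unfolding key_def by (auto simp: set_eq_iff)
    \<comment> \<open>This makes the map sending \<open>x\<close> to \<open>x'\<close> and
      \<open>y\<close> to \<open>y'\<close> well defined when the two points coincide.\<close>
    have "x = y \<Longrightarrow> x' = y'"
      using lt[of 1] lt_total[of 1 x' y'] pos F FM by auto
    then have "\<exists>g. automorphism n M R g \<and> (\<forall>z\<in>{x, y}. g z = (if z = x then x' else y'))"
      by (intro extend_embedding) (use that lt F FM in \<open>auto split: if_splits\<close>)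
    then obtain g where g: "automorphism n M R g" "g x = x'" "g y = (if y = x then x' else y')"
      by auto
    then have "g y = y'" using \<open>x = y \<Longrightarrow> x' = y'\<close> by auto
    with g F show ?thesis by auto
  qed
  ultimately show ?thesis by blast
qed

text \<open>With the signs read off from \<open>g\<close> and \<open>h\<close>, every point of
  \<open>g\<close> F\<open>is dominated by every point of\<close>h \<open>F\<close>. An arbitrary
  pair is first moved into \<open>F\<close> by some \<open>k\<close>; pulling a point of
  \<open>h\<close> F\<open>back along\<close>g \<circ>
  k\<open>gives an upper bound, and pulling a point of\<close>g \<open>F\<close> back along
  \<open>h \<circ> k\<close> gives a lower bound.\<close>

lemma directed_signs:
  obtains s where
    "\<And>x y. x \<in> M \<Longrightarrow> y \<in> M \<Longrightarrow> \<exists>z. homogeneous_orders.dominated n M (flip s R) x z \<and>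
      homogeneous_orders.dominated n M (flip s R) y z"
    "\<And>x y. x \<in> M \<Longrightarrow> y \<in> M \<Longrightarrow> \<exists>z. homogeneous_orders.dominated n M (flip s R) z x \<and>
      homogeneous_orders.dominated n M (flip s R) z y"
proof -
  obtain F where F: "finite F" "F \<subseteq> M"
    and pairs: "\<And>x y. x \<in> M \<Longrightarrow> y \<in> M \<Longrightarrow> \<exists>k. automorphism n M R k \<and> k x \<in> F \<and> k y \<in> F"
    using finite_pair_representatives by blast
  obtain g h where g: "automorphism n M R g" and h: "automorphism n M R h"
    and sep: "\<And>i. i \<in> {1..n} \<Longrightarrow>
      (\<forall>x\<in>F. \<forall>y\<in>F. lt i (g x) (h y)) \<or> (\<forall>x\<in>F. \<forall>y\<in>F. lt i (h y) (g x))"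
    using separated_copies[OF F order.refl] by blast
  define s where "s = (\<lambda>i. \<forall>x\<in>F. \<forall>y\<in>F. lt i (g x) (h y))"
  interpret flipped: homogeneous_orders n M "flip s R"
    using linear homogeneous infinite_carrier pos by unfold_locales auto
  have lt: "flipped.lt i x y \<longleftrightarrow> (if s i then lt i x y else lt i y x)" for i x y
    by (auto simp: flipped.lt_def lt_def flip_def)
  have gh: "flipped.dominated (g x) (h y)" if "x \<in> F" "y \<in> F" for x y
  proof -
    have "g x \<in> M" "h y \<in> M"
      using that F automorphism_closed[OF g] automorphism_closed[OF h] by auto
    moreover have "flipped.lt i (g x) (h y)" if "i \<in> {1..n}" for i
    proof (cases "s i")
      case True
      then have "lt i (g x) (h y)" using \<open>x \<in> F\<close> \<open>y \<in> F\<close> unfolding s_def by blast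
      with True show ?thesis by (simp add: lt)
    next
      case False
      then have "lt i (h y) (g x)" using sep[OF that] \<open>x \<in> F\<close> \<open>y \<in> F\<close> unfolding s_def by blast
      with False show ?thesis by (simp add: lt)
    qed
    ultimately show ?thesis by (simp add: flipped.dominated_def)
  qed
  have pull: "flipped.dominated (k x) (k y) \<longleftrightarrow> flipped.dominated x y"
    if "automorphism n M R k" "x \<in> M" "y \<in> M" for k x y
    using flipped.automorphism_dominated[of k x y] that by simp
  show ?thesis
  proof (rule that[of s])
    fix x y assume xy: "x \<in> M" "y \<in> M"
    then obtain k where k: "automorphism n M R k" "k x \<in> F" "k y \<in> F" using pairs by blast
    have gk: "automorphism n M R (g \<circ> k)" and hk: "automorphism n M R (h \<circ> k)"
      using automorphism_comp g h k by auto
    have "h (k x) \<in> M" "g (k x) \<in> M"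
      using automorphism_closed[OF g] automorphism_closed[OF h] k F by auto
    then obtain z w where z: "z \<in> M" "(g \<circ> k) z = h (k x)" and w: "w \<in> M" "(h \<circ> k) w = g (k x)"
      using automorphism_surj[OF gk] automorphism_surj[OF hk] by blast
    show "\<exists>z. flipped.dominated x z \<and> flipped.dominated y z"
      using pull[OF gk xy(1) z(1)] pull[OF gk xy(2) z(1)] z gh k by auto
    show "\<exists>z. flipped.dominated z x \<and> flipped.dominated z y"
      using pull[OF hk w(1) xy(1)] pull[OF hk w(1) xy(2)] w gh k by auto
  qed
qed

end

section \<open>Density of the dominance order\<close>

text \<open>Variables 0 and 1 are kept for the arguments of the definable relation, so dominance is
  expressed between 2 and 3. The atom \<open>EqF 2 2\<close> serves as truth for the empty
  conjunction.\<close>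

definition dominated_fm :: "nat list \<Rightarrow> fm" where
  "dominated_fm is = foldr (\<lambda>i. ConjF (ConjF (RelF i 2 3) (NegF (EqF 2 3)))) is (EqF 2 2)"

lemma sat_dominated_fm:
  "sat M R v (dominated_fm is) \<longleftrightarrow> (\<forall>i\<in>set is. (v 2, v 3) \<in> R i \<and> v 2 \<noteq> v 3)"
  by (induction "is") (auto simp: dominated_fm_def)

lemma symbols_dominated_fm:
  "free_vars (dominated_fm is) \<subseteq> {2, 3}" "rel_symbols (dominated_fm is) \<subseteq> set is"
  by (induction "is") (auto simp: dominated_fm_def)

text \<open>This is the situation after the signs have been chosen. Mere distinctness is the trace
  left by excluding both equal and opposite orders before the reversal.\<close>

locale directed_orders = homogeneous_orders +
  assumes distinct: "i \<in> {1..n} \<Longrightarrow> j \<in> {1..n} \<Longrightarrow> i \<noteq> j \<Longrightarrow> R i \<noteq> R j"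
    and primitive: "i \<in> {1..n} \<Longrightarrow> topologically_primitive n M R i"
    and directed_up: "x \<in> M \<Longrightarrow> y \<in> M \<Longrightarrow> \<exists>z. x \<lless> z \<and> y \<lless> z"
    and directed_down: "x \<in> M \<Longrightarrow> y \<in> M \<Longrightarrow> \<exists>z. z \<lless> x \<and> z \<lless> y"
begin

text \<open>Take \<open>e\<close> dominated by \<open>a\<close>. The pairs \<open>(e, b)\<close> and
  \<open>(a, b)\<close> are conjugate, and the automorphism moves \<open>a\<close>, which lies
  between \<open>e\<close> and \<open>b\<close>, to a point between \<open>a\<close> and
  \<open>b\<close>.\<close>

lemma dense:
  assumes "a \<lless> b"
  shows "\<exists>c. a \<lless> c \<and> c \<lless> b"
proof -
  have M: "a \<in> M" "b \<in> M" using assms dominated_carrier by auto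
  obtain e where e: "e \<lless> a" using directed_down[OF M(1) M(1)] by blast
  then have eM: "e \<in> M" and eb: "e \<lless> b" using dominated_carrier dominated_trans assms by blast+
  have "\<exists>g. automorphism n M R g \<and> (\<forall>x\<in>{e, b}. g x = (if x = e then a else b))"
  proof (rule extend_embedding)
    fix i x y assume "i \<in> {1..n}" "x \<in> {e, b}" "y \<in> {e, b}" "lt i x y"
    then show "lt i (if x = e then a else b) (if y = e then a else b)"
      using dominatedD[OF eb, of i] dominatedD[OF assms, of i] lt_asym[of i e b] by auto
  qed (use M eM in auto)
  then obtain g where g: "automorphism n M R g" "g e = a" "g b = b"
    using dominated_neq[OF eb] by auto
  have "g e \<lless> g a" "g a \<lless> g b"
    using automorphism_dominated[OF g(1)] e assms M eM by auto
  with g show ?thesis by auto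
qed

lemma interval_contains_dominated_pair:
  assumes j: "j \<in> {1..n}" and xy: "lt j x y"
  shows "\<exists>u v. u \<lless> v \<and> (x, u) \<in> R j \<and> (v, y) \<in> R j"
proof -
  define btw where "btw x y \<longleftrightarrow> (\<exists>u v. u \<lless> v \<and> (x, u) \<in> R j \<and> (v, y) \<in> R j)" for x y
  define E where "E = {(x, y) \<in> M \<times> M. \<not> btw x y \<and> \<not> btw y x}"
  have tr: "trans (R j)" using linear[OF j] by (simp add: order_on_defs)
  have btw_lt: "lt j x y" if "btw x y" for x y
  proof -
    from that obtain u v where uv: "u \<lless> v" "(x, u) \<in> R j" "(v, y) \<in> R j"
      unfolding btw_def by blast
    have "lt j x v" using uv dominatedD[OF uv(1) j] rel_iff_lt[OF j, of x u] lt_trans[OF j, of x u v]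
      by auto
    then show ?thesis using uv rel_iff_lt[OF j, of v y] lt_trans[OF j, of x v y] by auto
  qed
  have btw_mono: "btw x y" if "btw x z" "(z, y) \<in> R j" for x y z
    using that tr unfolding btw_def by (meson transD)
  \<comment> \<open>This yields transitivity of \<open>E\<close>. Density cuts the pair
    \<open>u \<lless> v\<close> at \<open>c\<close>; according to the side of \<open>c\<close> on
    which \<open>y\<close> lies in order \<open>j\<close>, the lower or the upper half serves as the
    new witness.\<close>
  have split: "btw x y \<or> btw y z" if xz: "btw x z" and y: "y \<in> M" for x y z
  proof -
    from xz obtain u v where uv: "u \<lless> v" "(x, u) \<in> R j" "(v, z) \<in> R j"
      unfolding btw_def by blast
    obtain c where c: "u \<lless> c" "c \<lless> v" using dense[OF uv(1)] by blast
    then have "(c, y) \<in> R j \<or> (y, c) \<in> R j"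
      using rel_iff_not_lt[OF j] lt_asym[OF j] y dominated_carrier by blast
    then show ?thesis using c uv unfolding btw_def by blast
  qed
  have equiv: "equiv M E"
  proof (rule equivI)
    show "refl_on M E" using btw_lt lt_irrefl unfolding refl_on_def E_def by blast
    show "sym E" by (auto simp: sym_def E_def)
    show "trans E"
    proof (rule transI)
      fix x y z assume "(x, y) \<in> E" "(y, z) \<in> E"
      then show "(x, z) \<in> E" using split[of x z y] split[of z x y] unfolding E_def by auto
    qed
  qed (auto simp: E_def)
  have convex: "convex_in M (R j) C" if "C \<in> M // E" for C
    unfolding convex_in_def
  proof (intro ballI impI)
    fix x y z assume x: "x \<in> C" and y: "y \<in> C" and z: "z \<in> M" and xz: "(x, z) \<in> R j \<and> (z, y) \<in> R j"
    have "(x, y) \<in> E" using quotient_eq_iff[OF equiv that that x y] by simp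
    then have "\<not> btw x z" "x \<in> M" using btw_mono xz unfolding E_def by auto
    moreover have "\<not> btw z x" using btw_lt[of z x] xz rel_iff_not_lt[OF j \<open>x \<in> M\<close> z] by auto
    ultimately have "(x, z) \<in> E" using z by (simp add: E_def)
    then show "z \<in> C" using in_quotient_imp_closed[OF equiv that x] by simp
  qed
  define half where "half a b = NegF (ExF 2 (ExF 3
    (ConjF (dominated_fm [1..<Suc n]) (ConjF (RelF j a 2) (RelF j 3 b)))))" for a b
  have half: "sat M R v (half a b) \<longleftrightarrow> \<not> btw (v a) (v b)" if "a < 2" "b < 2" for v a b
  proof -
    have "u \<lless> w \<longleftrightarrow> u \<in> M \<and> w \<in> M \<and> (\<forall>i\<in>set [1..<Suc n]. (u, w) \<in> R i \<and> u \<noteq> w)" for u w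
      by (auto simp: dominated_def lt_def)
    then show ?thesis
      using that unfolding half_def btw_def by (simp add: sat_dominated_fm del: upt_Suc) blast
  qed
  have "rel_symbols (ConjF (half 0 1) (half 1 0)) \<subseteq> {1..n}"
    "free_vars (ConjF (half 0 1) (half 1 0)) \<subseteq> {0, 1}"
    using symbols_dominated_fm[of "[1..<Suc n]"] j unfolding half_def by auto
  moreover have "E = {(a, b) \<in> M \<times> M.
      sat M R (\<lambda>k. if k = 0 then a else b) (ConjF (half 0 1) (half 1 0))}"
    by (auto simp: E_def half)
  ultimately have "definable_rel n M R E"
    unfolding definable_rel_def by blast
  \<comment> \<open>A point \<open>z\<close> dominating \<open>x\<close> is not equivalent to
    \<open>x\<close>, as \<open>x\<close> and \<open>z\<close> are themselves the dominated pair in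
    the interval.\<close>
  moreover have "\<exists>C \<in> M // E. \<exists>D \<in> M // E. C \<noteq> D"
  proof -
    have x: "x \<in> M" using lt_carrier[OF j xy] by simp
    then obtain z where z: "x \<lless> z" using directed_up by blast
    then have zM: "z \<in> M" using dominated_carrier by blast
    have "btw x z" unfolding btw_def using z x zM rel_iff_lt[OF j] by blast
    then have "(x, z) \<notin> E" by (simp add: E_def)
    then have "E `` {x} \<noteq> E `` {z}" using eq_equiv_class[OF _ equiv zM] by metis
    then show ?thesis using x zM by (meson quotientI)
  qed
  ultimately have "E = Id_on M"
    using primitive[OF j] equiv convex unfolding topologically_primitive_def by blast
  moreover have "x \<in> M" "y \<in> M" "x \<noteq> y" using lt_carrier[OF j xy] xy by auto
  ultimately have "btw x y \<or> btw y x" unfolding E_def by blast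
  then show ?thesis using btw_lt[of y x] lt_asym[OF j xy] unfolding btw_def by blast
qed

text \<open>Inside the interval lie \<open>c \<lless> d\<close>, with \<open>x\<close> below
  \<open>c\<close> and \<open>d\<close> below \<open>y\<close> in order \<open>j\<close>. The chain
  is completed to \<open>b \<lless> c \<lless> d \<lless> e \<lless> f\<close> with \<open>x\<close>
  between \<open>b\<close> and \<open>e\<close>, and an automorphism \<open>g\<close> shifts it by
  one step. Then \<open>g x\<close> dominates \<open>x\<close>, while in order \<open>j\<close> it
  stays below \<open>d\<close>.\<close>

lemma dominating_below:
  assumes j: "j \<in> {1..n}" and xy: "lt j x y"
  shows "\<exists>x'. x \<lless> x' \<and> lt j x' y"
proof -
  obtain u v where uv: "u \<lless> v" "(x, u) \<in> R j" "(v, y) \<in> R j"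
    using interval_contains_dominated_pair[OF j xy] by blast
  obtain c where c: "u \<lless> c" "c \<lless> v" using dense[OF uv(1)] by blast
  obtain d where d: "c \<lless> d" "d \<lless> v" using dense[OF c(2)] by blast
  have xc: "lt j x c"
    using uv(2) rel_iff_lt[OF j, of x u] dominatedD[OF c(1) j] lt_trans[OF j, of x u c] by auto
  have dy: "lt j d y"
    using uv(3) rel_iff_lt[OF j, of v y] dominatedD[OF d(2) j] lt_trans[OF j, of d v y] by auto
  have M: "x \<in> M" "c \<in> M" "d \<in> M" using lt_carrier[OF j] xc dy by blast+
  obtain b where b: "b \<lless> x" "b \<lless> c" using directed_down[OF M(1,2)] by blast
  obtain e where e: "x \<lless> e" "d \<lless> e" using directed_up[OF M(1,3)] by blast
  obtain f where f: "e \<lless> f" using directed_up[of e e] dominated_carrier[OF e(1)] by blast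
  have M': "b \<in> M" "e \<in> M" "f \<in> M" using b e f dominated_carrier by blast+
  have order: "b \<lless> c" "b \<lless> d" "b \<lless> e" "c \<lless> d" "c \<lless> e" "c \<lless> f" "d \<lless> e" "d \<lless> f" "e \<lless> f"
    using b d e f dominated_trans by blast+
  note neq = order[THEN dominated_neq]
  define shift where "shift z = (if z = b then c else if z = c then d else if z = d then e else f)" for z
  have shift: "shift b = c" "shift c = d" "shift d = e" "shift e = f"
    using neq by (auto simp: shift_def)
  have "\<exists>g. automorphism n M R g \<and> (\<forall>z\<in>{b, c, d, e}. g z = shift z)"
  proof (rule extend_embedding)
    fix i z w assume i: "i \<in> {1..n}" and zw: "z \<in> {b, c, d, e}" "w \<in> {b, c, d, e}" "lt i z w"
    show "lt i (shift z) (shift w)"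
      using zw order[THEN dominatedD, OF i] order[THEN dominatedD, OF i, THEN lt_asym[OF i]]
      by (elim insertE emptyE) (simp_all add: shift)
  qed (use M M' in \<open>auto simp: shift_def\<close>)
  then obtain g where g: "automorphism n M R g" "g b = c" "g c = d" "g d = e" "g e = f"
    using shift by auto
  have gM: "g x \<in> M" using automorphism_closed[OF g(1) M(1)] .
  have "x \<noteq> c" "x \<noteq> d"
    using xc dominatedD[OF d(1) j] lt_asym[OF j] lt_trans[OF j] by (metis lt_irrefl)+
  have "lt i x (g x)" if i: "i \<in> {1..n}" for i
  proof -
    \<comment> \<open>In each order \<open>x\<close> lies in one of the gaps from \<open>b\<close>
      to \<open>c\<close>, from \<open>c\<close> to \<open>d\<close>, or from \<open>d\<close> to
      \<open>e\<close>. The shift moves it past the upper end of that gap.\<close>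
    consider "lt i x c" | "lt i c x" "lt i x d" | "lt i d x"
      using lt_total[OF i M(1,2)] lt_total[OF i M(1,3)] \<open>x \<noteq> c\<close> \<open>x \<noteq> d\<close> by blast
    then show ?thesis
    proof cases
      case 1
      have "lt i c (g x)"
        using automorphism_lt[OF g(1) i M'(1) M(1)] dominatedD[OF b(1) i] g by simp
      then show ?thesis using 1 lt_trans[OF i] by blast
    next
      case 2
      then have "lt i d (g x)" using automorphism_lt[OF g(1) i M(2,1)] g by simp
      then show ?thesis using 2 lt_trans[OF i] by blast
    next
      case 3
      then have "lt i e (g x)" using automorphism_lt[OF g(1) i M(3,1)] g by simp
      then show ?thesis using dominatedD[OF e(1) i] lt_trans[OF i] by blast
    qed
  qed
  then have "x \<lless> g x" using M gM by (simp add: dominated_def)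
  moreover have "lt j (g x) d" using automorphism_lt[OF g(1) j M(1,2)] xc g by simp
  then have "lt j (g x) y" using dy lt_trans[OF j] by blast
  ultimately show ?thesis by blast
qed

section \<open>Points over chains\<close>

definition chain :: "(nat \<Rightarrow> 'a) \<Rightarrow> bool" where
  "chain a \<longleftrightarrow> (\<forall>k. a k \<lless> a (Suc k))"

text \<open>The \<open>n\<close> orders act as coordinates, and \<open>p i\<close> is the index of
  the gap holding the \<open>i\<close>-th coordinate. Gaps are open, and none lies below
  \<open>a 0\<close>.\<close>

definition cell :: "(nat \<Rightarrow> 'a) \<Rightarrow> (nat \<Rightarrow> nat) \<Rightarrow> 'a \<Rightarrow> bool" where
  "cell a p x \<longleftrightarrow> x \<in> M \<and> (\<forall>i\<in>{1..n}. lt i (a (p i)) x \<and> lt i x (a (Suc (p i))))"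

text \<open>
  The factor 2 leaves an empty gap of the chain between any two gaps occupied by coordinates of
  the point; this is what allows arbitrary refinements and coarsenings of the chain.
\<close>

definition realized :: "(nat \<Rightarrow> nat) \<Rightarrow> bool" where
  "realized q \<longleftrightarrow> (\<exists>a x. chain a \<and> cell a (\<lambda>i. 2 * q i) x)"

definition separable :: "nat set \<Rightarrow> bool" where
  "separable S \<longleftrightarrow> realized (\<lambda>i. if i \<in> S then 0 else 1)"

section \<open>Chains and their refinements\<close>

lemma chain_less:
  assumes "chain a" "k < l"
  shows "a k \<lless> a l"
  using assms(2)
proof (induct k l rule: less_Suc_induct)
  case (1 k)
  then show ?case using assms(1) by (simp add: chain_def)
qed (rule dominated_trans)

lemma chain_carrier: "chain a \<Longrightarrow> a k \<in> M"
  using dominated_carrier unfolding chain_def by blast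

lemma chain_below:
  assumes "chain a" "i \<in> {1..n}" "lt i x (a k)" "k \<le> l"
  shows "lt i x (a l)"
proof (cases "k = l")
  case False
  then have "lt i (a k) (a l)" using chain_less[of a k l] assms dominatedD by simp
  then show ?thesis using lt_trans[OF assms(2,3)] by blast
qed (use assms in simp)

lemma chain_above:
  assumes "chain a" "i \<in> {1..n}" "lt i (a l) x" "k \<le> l"
  shows "lt i (a k) x"
proof (cases "k = l")
  case False
  then have "lt i (a k) (a l)" using chain_less[of a k l] assms dominatedD by simp
  then show ?thesis using lt_trans[OF assms(2) _ assms(3)] by blast
qed (use assms in simp)

text \<open>Initial segments of equal length of two chains are isomorphic, so homogeneity carries
  one to the other, and the point along with it.\<close>

lemma cell_transfer:
  assumes a: "chain a" and b: "chain b" and x: "cell a p x"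
  shows "\<exists>y. cell b p y"
proof -
  \<comment> \<open>The strict bound ensures that the segment up to \<open>N\<close> contains the
    upper end \<open>Suc (p i)\<close> of every gap involved.\<close>
  obtain N where N: "\<And>i. i \<in> {1..n} \<Longrightarrow> p i < N"
    using finite_nat_set_iff_bounded[of "p ` {1..n}"]
    by (metis finite_atLeastAtMost finite_imageI imageI)
  have inj: "inj a"
    by (rule linorder_injI) (use chain_less[OF a] dominated_neq in blast)
  have xM: "x \<in> M" using x by (simp add: cell_def)
  have "\<exists>g. automorphism n M R g \<and> (\<forall>z\<in>a ` {..N}. g z = b (inv a z))"
  proof (rule extend_embedding)
    fix i z w assume i: "i \<in> {1..n}" and "z \<in> a ` {..N}" "w \<in> a ` {..N}" and zw: "lt i z w"
    then obtain k l where kl: "z = a k" "w = a l" by blast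
    have "k < l"
    proof (rule ccontr)
      assume "\<not> k < l"
      then have "k = l \<or> lt i w z" using chain_less[OF a, of l k] dominatedD i kl by fastforce
      then show False using zw kl lt_asym[OF i] by auto
    qed
    then show "lt i (b (inv a z)) (b (inv a w))"
      using chain_less[OF b] dominatedD i kl inj by simp
  qed (use chain_carrier[OF a] chain_carrier[OF b] in auto)
  then obtain g where g: "automorphism n M R g" and "\<forall>z\<in>a ` {..N}. g z = b (inv a z)" by blast
  then have gab: "g (a k) = b k" if "k \<le> N" for k using that inj by simp
  have "cell b p (g x)"
    unfolding cell_def
  proof (intro conjI ballI)
    show "g x \<in> M" using automorphism_closed[OF g xM] .
    fix i assume i: "i \<in> {1..n}"
    then have "lt i (a (p i)) x" "lt i x (a (Suc (p i)))" using x by (auto simp: cell_def)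
    then have "lt i (g (a (p i))) (g x)" "lt i (g x) (g (a (Suc (p i))))"
      using automorphism_lt[OF g i] xM chain_carrier[OF a] by auto
    then show "lt i (b (p i)) (g x)" "lt i (g x) (b (Suc (p i)))"
      using gab N[OF i] by auto
  qed
  then show ?thesis by blast
qed

lemma exists_chain_from:
  assumes "u \<in> M"
  shows "\<exists>a. chain a \<and> a 0 = u"
proof -
  have "\<exists>a. \<forall>k. (a k \<in> M \<and> (k = 0 \<longrightarrow> a k = u)) \<and> a k \<lless> a (Suc k)"
  proof (rule dependent_nat_choice)
    show "\<exists>x. x \<in> M \<and> (0 = (0::nat) \<longrightarrow> x = u)" using assms by blast
    fix x and k :: nat assume "x \<in> M \<and> (k = 0 \<longrightarrow> x = u)"
    then obtain y where "x \<lless> y" using directed_up by blast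
    then show "\<exists>y. (y \<in> M \<and> (Suc k = 0 \<longrightarrow> y = u)) \<and> x \<lless> y" using dominated_carrier by blast
  qed
  then show ?thesis by (auto simp: chain_def)
qed

lemma exists_chain: "\<exists>a. chain a"
  using exists_chain_from infinite_carrier by (metis ex_in_conv finite.emptyI)

lemma exists_chain_between:
  assumes "u \<lless> v"
  shows "\<exists>c. chain c \<and> (\<forall>k. u \<lless> c k \<and> c k \<lless> v)"
proof -
  have "\<exists>c. \<forall>k::nat. (u \<lless> c k \<and> c k \<lless> v) \<and> c k \<lless> c (Suc k)"
  proof (rule dependent_nat_choice)
    show "\<exists>x. u \<lless> x \<and> x \<lless> v" using dense[OF assms] .
    fix x assume x: "u \<lless> x \<and> x \<lless> v"
    then obtain y where "x \<lless> y" "y \<lless> v" using dense by blast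
    with x show "\<exists>y. (u \<lless> y \<and> y \<lless> v) \<and> x \<lless> y" using dominated_trans by blast
  qed
  then show ?thesis by (auto simp: chain_def)
qed

text \<open>A chain \<open>b\<close> is built whose members \<open>2 * m\<close> and
  \<open>2 * m + 1\<close> both lie inside gap \<open>h m\<close> of \<open>a\<close>. A point whose
  coordinates occupy the gaps \<open>2 * q i\<close> of \<open>b\<close> then occupies the gaps
  \<open>h (q i)\<close> of \<open>a\<close>.\<close>

lemma realized_imp_cell:
  assumes q: "realized q" and h: "mono h" and a: "chain a"
  shows "\<exists>x. cell a (\<lambda>i. h (q i)) x"
proof -
  have "\<forall>m. \<exists>c. chain c \<and> (\<forall>k. a m \<lless> c k \<and> c k \<lless> a (Suc m))"
    using exists_chain_between a by (auto simp: chain_def)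
  then obtain c where c: "\<And>m. chain (c m)" "\<And>m k. a m \<lless> c m k" "\<And>m k. c m k \<lless> a (Suc m)"
    by metis
  \<comment> \<open>The odd gaps of \<open>b\<close> absorb the jumps of \<open>h\<close>. Using
    \<open>k\<close> also as the index within the inner chain keeps \<open>b\<close> increasing
    where \<open>h\<close> is constant.\<close>
  define b where "b k = c (h (k div 2)) k" for k
  have "chain b"
    unfolding chain_def
  proof
    fix k
    have "h (k div 2) \<le> h (Suc k div 2)" by (rule monoD[OF h]) (simp add: div_le_mono)
    then consider "h (k div 2) = h (Suc k div 2)" | "Suc (h (k div 2)) \<le> h (Suc k div 2)"
      by linarith
    then show "b k \<lless> b (Suc k)"
    proof cases
      case 1
      then show ?thesis using c(1)[of "h (k div 2)"] by (simp add: b_def chain_def)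
    next
      case 2
      then have "a (Suc (h (k div 2))) = a (h (Suc k div 2)) \<or>
          a (Suc (h (k div 2))) \<lless> a (h (Suc k div 2))"
        using chain_less[OF a] by (metis le_neq_implies_less)
      then show ?thesis
        unfolding b_def using c(2,3) dominated_trans by metis
    qed
  qed
  then obtain y where y: "cell b (\<lambda>i. 2 * q i) y"
    using q cell_transfer unfolding realized_def by blast
  have "cell a (\<lambda>i. h (q i)) y"
    unfolding cell_def
  proof (intro conjI ballI)
    show "y \<in> M" using y by (simp add: cell_def)
    fix i assume i: "i \<in> {1..n}"
    then have "lt i (c (h (q i)) (2 * q i)) y" "lt i y (c (h (q i)) (Suc (2 * q i)))"
      using y by (auto simp: cell_def b_def)
    then show "lt i (a (h (q i))) y" "lt i y (a (Suc (h (q i))))"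
      using c(2,3)[THEN dominatedD, OF i] lt_trans[OF i] by blast+
  qed
  then show ?thesis by blast
qed

lemma realized_comp:
  assumes "realized q" "mono h"
  shows "realized (\<lambda>i. h (q i))"
proof -
  obtain a where a: "chain a" using exists_chain by blast
  have "mono (\<lambda>k. 2 * h k)" using assms(2) by (simp add: mono_def)
  from realized_imp_cell[OF assms(1) this a] show ?thesis
    unfolding realized_def using a by blast
qed

lemma realized_cong:
  "realized q \<Longrightarrow> (\<And>i. i \<in> {1..n} \<Longrightarrow> q i = q' i) \<Longrightarrow> realized q'"
  unfolding realized_def cell_def by simp

lemma realized_zero: "realized (\<lambda>_. 0)"
proof -
  obtain a where a: "chain a" using exists_chain by blast
  then obtain x where "a 0 \<lless> x" "x \<lless> a (Suc 0)" using dense unfolding chain_def by blast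
  then have "cell a (\<lambda>i. 2 * 0) x"
    by (auto simp: cell_def dest: dominatedD dominated_carrier)
  with a show ?thesis unfolding realized_def by blast
qed

text \<open>
  Points with the two-block pattern of \<open>S\<close> form a new chain along which the coordinates in \<open>S\<close>
  lag behind the others by a constant amount. Measured against that chain, the coordinates in \<open>S\<close>
  of any other point are moved up by this amount.
\<close>

lemma realized_add:
  assumes q: "realized q" and S: "separable S"
  shows "realized (\<lambda>i. q i + (if i \<in> S then c else 0))"
proof -
  obtain a where a: "chain a" using exists_chain by blast
  \<comment> \<open>The new chain \<open>x\<close> will use even gaps of \<open>a\<close> and the
    point \<open>y\<close> odd ones, so no ties arise. Coordinate \<open>i\<close> of
    \<open>y\<close> is in gap \<open>4 * (q i + c) + 1\<close>, just after that of
    \<open>x t\<close>, where \<open>t\<close> is \<open>2 * (q i + c)\<close> for \<open>i\<close>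
    in \<open>S\<close> and \<open>2 * q i\<close> otherwise.\<close>
  have "mono (\<lambda>k. 2 * (2 * k + 2 * c) + 1)" by (simp add: mono_def)
  from realized_imp_cell[OF q this a]
  obtain y where y: "cell a (\<lambda>i. 2 * (2 * q i + 2 * c) + 1) y" by blast
  have "\<exists>x. cell a (\<lambda>i. if i \<in> S then 2 * t else 2 * (t + 2 * c)) x" for t
  proof -
    have "mono (\<lambda>k::nat. if k = 0 then 2 * t else 2 * (t + 2 * c))" by (simp add: mono_def)
    from realized_imp_cell[OF S[unfolded separable_def] this a]
    have "\<exists>x. cell a (\<lambda>i. if (if i \<in> S then 0 else 1) = (0::nat) then 2 * t else 2 * (t + 2 * c)) x" .
    moreover have "(\<lambda>i. if (if i \<in> S then 0 else 1) = (0::nat) then 2 * t else 2 * (t + 2 * c)) =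
        (\<lambda>i. if i \<in> S then 2 * t else 2 * (t + 2 * c))"
      by auto
    ultimately show ?thesis by metis
  qed
  then obtain x where x: "\<And>t. cell a (\<lambda>i. if i \<in> S then 2 * t else 2 * (t + 2 * c)) (x t)" by metis
  have xM: "x t \<in> M" for t using x[of t] by (simp add: cell_def)
  have below: "lt i (x t) (a k)"
    if "i \<in> {1..n}" "(if i \<in> S then 2 * t else 2 * (t + 2 * c)) < k" for i t k
    using x[of t] that chain_below[OF a that(1), of "x t" "Suc (if i \<in> S then 2 * t else 2 * (t + 2 * c))" k]
    by (auto simp: cell_def)
  have above: "lt i (a k) (x t)"
    if "i \<in> {1..n}" "k \<le> (if i \<in> S then 2 * t else 2 * (t + 2 * c))" for i t k
    using x[of t] that chain_above[OF a that(1), of "if i \<in> S then 2 * t else 2 * (t + 2 * c)" "x t" k]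
    by (auto simp: cell_def)
  have "chain x"
    unfolding chain_def dominated_def
  proof (intro allI conjI ballI)
    fix t i assume i: "i \<in> {1..n}"
    let ?k = "Suc (if i \<in> S then 2 * t else 2 * (t + 2 * c))"
    show "lt i (x t) (x (Suc t))"
      using below[OF i, of t ?k] above[OF i, of ?k "Suc t"] lt_trans[OF i, of _ "a ?k"] by auto
  qed (use xM in auto)
  moreover have "cell x (\<lambda>i. 2 * (q i + (if i \<in> S then c else 0))) y"
    unfolding cell_def
  proof (intro conjI ballI)
    show "y \<in> M" using y by (simp add: cell_def)
    fix i assume i: "i \<in> {1..n}"
    let ?t = "2 * (q i + (if i \<in> S then c else 0))" and ?k = "2 * (2 * q i + 2 * c) + 1"
    have y': "lt i (a ?k) y" "lt i y (a (Suc ?k))" using y i by (auto simp: cell_def)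
    have "lt i (x ?t) (a ?k)" by (rule below[OF i]) auto
    then show "lt i (x ?t) y" using y' lt_trans[OF i] by blast
    have "lt i (a (Suc ?k)) (x (Suc ?t))" by (rule above[OF i]) auto
    then show "lt i y (x (Suc ?t))" using y' lt_trans[OF i] by blast
  qed
  ultimately show ?thesis unfolding realized_def by blast
qed

section \<open>The separable sets form a Boolean algebra that isolates every index\<close>

lemma separable_Compl:
  assumes "separable S"
  shows "separable (- S)"
proof -
  \<comment> \<open>Adding 1 on \<open>S\<close> to the zero vector makes \<open>S\<close> the upper
    block, which exchanges the two blocks.\<close>
  have "realized (\<lambda>i. 0 + (if i \<in> S then 1 else 0))"
    by (rule realized_add[OF realized_zero assms])
  moreover have "(\<lambda>i. 0 + (if i \<in> S then 1 else 0::nat)) = (\<lambda>i. if i \<in> - S then 0 else 1)"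
    by auto
  ultimately show ?thesis unfolding separable_def by metis
qed

text \<open>The sum of the two indicators is 2 exactly on the intersection. Truncated subtraction of
  1 merges the values 0 and 1, which leaves the pattern of the complement of
  \<open>S \<inter> T\<close>.\<close>

lemma separable_Int:
  assumes "separable S" "separable T"
  shows "separable (S \<inter> T)"
proof -
  have "realized (\<lambda>i. 0 + (if i \<in> S then 1 else 0) + (if i \<in> T then 1 else 0))"
    by (rule realized_add[OF realized_add[OF realized_zero assms(1)] assms(2)])
  moreover have "mono (\<lambda>k::nat. k - 1)" by (auto simp: mono_def)
  ultimately have "realized (\<lambda>i. 0 + (if i \<in> S then 1 else 0) + (if i \<in> T then 1 else 0) - 1)"
    by (rule realized_comp)
  moreover have "(\<lambda>i. 0 + (if i \<in> S then 1 else 0) + (if i \<in> T then 1 else 0) - 1 :: nat) =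
      (\<lambda>i. if i \<in> - (S \<inter> T) then 0 else 1)"
    by auto
  ultimately have "separable (- (S \<inter> T))" unfolding separable_def by metis
  then show ?thesis using separable_Compl by fastforce
qed

text \<open>Where the two orders disagree, a chain is found that lies above \<open>y\<close> in
  order \<open>i\<close> and below \<open>y\<close> in order \<open>j\<close>. Some gap of it
  contains \<open>y\<close> in no order, and \<open>S\<close> collects the orders in which
  \<open>y\<close> is below that gap.\<close>

lemma separate_indices:
  assumes i: "i \<in> {1..n}" and j: "j \<in> {1..n}" and ij: "i \<noteq> j"
  shows "\<exists>S. separable S \<and> i \<in> S \<and> j \<notin> S"
proof -
  obtain x y where yx: "lt i y x" and xy: "lt j x y"
  proof -
    obtain u v where uv: "(u, v) \<in> R i \<longleftrightarrow> (u, v) \<notin> R j"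
      using distinct[OF i j ij] by auto
    then have "u \<in> M" "v \<in> M" using linear[OF i] linear[OF j] by (auto simp: order_on_defs)
    then show ?thesis
      using uv that[of v u] that[of u v] rel_iff_not_lt[OF i, of u v] rel_iff_not_lt[OF j, of u v]
        rel_iff_lt[OF i, of u v] rel_iff_lt[OF j, of u v] by blast
  qed
  obtain x' where x': "x \<lless> x'" "lt j x' y" using dominating_below[OF j xy] by blast
  obtain c where c: "chain c" "\<And>k. x \<lless> c k" "\<And>k. c k \<lless> x'"
    using exists_chain_between[OF x'(1)] by blast
  have yc: "lt i y (c k)" for k using lt_trans[OF i yx dominatedD[OF c(2) i]] .
  have cy: "lt j (c k) y" for k using lt_trans[OF j dominatedD[OF c(3) j] x'(2)] .
  have yM: "y \<in> M" using lt_carrier[OF j xy] by simp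
  have cM: "c k \<in> M" for k using chain_carrier[OF c(1)] .
  \<comment> \<open>Pigeonhole: in each order \<open>y\<close> lies in at most one gap of the chain,
    and there are \<open>n + 1\<close> gaps but only \<open>n\<close> orders.\<close>
  have "\<exists>t\<in>{..n}. \<forall>k\<in>{1..n}. \<not> (lt k (c t) y \<and> lt k y (c (Suc t)))"
  proof (rule ccontr)
    assume "\<not> ?thesis"
    then obtain f where f: "\<And>t. t \<in> {..n} \<Longrightarrow> f t \<in> {1..n} \<and>
        lt (f t) (c t) y \<and> lt (f t) y (c (Suc t))"
      by metis
    have "f t \<noteq> f r" if "t < r" "t \<le> n" "r \<le> n" for t r
    proof
      assume eq: "f t = f r"
      have "lt (f t) (c (Suc t)) y"
        using chain_above[OF c(1), of "f r" r y "Suc t"] f[of r] that eq by simp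
      then show False using f[of t] that lt_asym by simp
    qed
    then have "inj_on f {..n}" by (intro linorder_inj_onI) auto
    moreover have "f ` {..n} \<subseteq> {1..n}" using f by blast
    ultimately have "card {..n} \<le> card {1..n}" by (rule card_inj_on_le) simp
    then show False by simp
  qed
  then obtain t where t: "\<And>k. k \<in> {1..n} \<Longrightarrow> \<not> (lt k (c t) y \<and> lt k y (c (Suc t)))" by blast
  obtain b where b: "b \<lless> y" "b \<lless> c t" using directed_down[OF yM cM] by blast
  obtain e where e: "y \<lless> e" "c (Suc t) \<lless> e" using directed_up[OF yM cM] by blast
  obtain d where d: "chain d" "d 0 = e" using exists_chain_from dominated_carrier[OF e(1)] by blast
  \<comment> \<open>The empty gap becomes gap 1. Gap 0 reaches down to \<open>b\<close> below
    \<open>y\<close>, and gap 2 reaches up to \<open>e\<close> above \<open>y\<close>, so every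
    coordinate of \<open>y\<close> is in gap 0 or gap 2, as the factor 2 in \<open>realized\<close>
    demands.\<close>
  define a where "a k = (case k of 0 \<Rightarrow> b | Suc 0 \<Rightarrow> c t | Suc (Suc 0) \<Rightarrow> c (Suc t)
    | Suc (Suc (Suc m)) \<Rightarrow> d m)" for k
  have "a k \<lless> a (Suc k)" for k
    using b(2) e(2) c(1) d by (auto simp: a_def chain_def split: nat.split)
  then have chain: "chain a" by (simp add: chain_def)
  define S where "S = {k. lt k y (c t)}"
  have "cell a (\<lambda>k. 2 * (if k \<in> S then 0 else 1)) y"
    unfolding cell_def
  proof (intro conjI ballI)
    fix k assume k: "k \<in> {1..n}"
    have "lt k (c (Suc t)) y" if "k \<notin> S"
    proof -
      have "y \<noteq> c t" "y \<noteq> c (Suc t)" using yc lt_irrefl by metis+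
      then show ?thesis
        using that t[OF k] lt_total[OF k yM cM, of t] lt_total[OF k yM cM, of "Suc t"]
        by (auto simp: S_def)
    qed
    then show "lt k (a (2 * (if k \<in> S then 0 else 1))) y"
      "lt k y (a (Suc (2 * (if k \<in> S then 0 else 1))))"
      using dominatedD[OF b(1) k] dominatedD[OF e(1) k] d(2)
      by (auto simp: a_def S_def numeral_2_eq_2)
  qed (rule yM)
  then have "separable S" unfolding separable_def realized_def using chain by blast
  moreover have "i \<in> S" using yc by (simp add: S_def)
  moreover have "j \<notin> S" using cy lt_asym[OF j] by (simp add: S_def)
  ultimately show ?thesis by blast
qed

text \<open>Sets separating \<open>i\<close> from each other index are intersected, starting from
  \<open>UNIV\<close>, whose pattern is the zero vector.\<close>

lemma separable_singleton:
  assumes i: "i \<in> {1..n}"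
  shows "\<exists>S. separable S \<and> S \<inter> {1..n} = {i}"
proof -
  have "\<exists>S. separable S \<and> i \<in> S \<and> S \<inter> J = {}" if "finite J" "J \<subseteq> {1..n} - {i}" for J
    using that
  proof (induction J rule: finite_induct)
    case empty
    have "separable UNIV" unfolding separable_def using realized_zero by simp
    then show ?case by blast
  next
    case (insert j J)
    then obtain S T where "separable S" "i \<in> S" "S \<inter> J = {}" "separable T" "i \<in> T" "j \<notin> T"
      using separate_indices[OF i, of j] by auto
    then show ?case using separable_Int[of S T] by blast
  qed
  from this[of "{1..n} - {i}"] show ?thesis using i by blast
qed

text \<open>The vector is built one coordinate at a time: \<open>q k\<close> is added on a separable
  set that meets the index range only in \<open>k\<close>.\<close>

lemma realized_all: "realized q"
proof -
  have "realized (\<lambda>i. if i \<in> K then q i else 0)" if "finite K" "K \<subseteq> {1..n}" for K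
    using that
  proof (induction K rule: finite_induct)
    case empty
    then show ?case using realized_zero by simp
  next
    case (insert k K)
    then obtain S where S: "separable S" "S \<inter> {1..n} = {k}" using separable_singleton by blast
    have "realized (\<lambda>i. (if i \<in> K then q i else 0) + (if i \<in> S then q k else 0))"
      using realized_add[OF _ S(1)] insert by blast
    then show ?case
    proof (rule realized_cong)
      fix i assume "i \<in> {1..n}"
      then have "i \<in> S \<longleftrightarrow> i = k" using S(2) by blast
      then show "(if i \<in> K then q i else 0) + (if i \<in> S then q k else 0) =
          (if i \<in> insert k K then q i else 0)"
        using insert.hyps by auto
    qed
  qed
  from this[of "{1..n}"] have "realized (\<lambda>i. if i \<in> {1..n} then q i else 0)" by blast
  then show ?thesis by (rule realized_cong) simp
qed

section \<open>Embedding finite multiorders and computing the age\<close>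

lemma embeds_finite_multiorder:
  assumes A: "finite A" and S: "\<And>i. i \<in> {1..n} \<Longrightarrow> linear_order_on A (S i)"
  shows "\<exists>f. embedding n A S M R f"
proof -
  obtain a where a: "chain a" using exists_chain by blast
  \<comment> \<open>The rank of \<open>x\<close> in order \<open>i\<close>. Elements of different
    rank receive different gaps, so their images are ordered as they should be.\<close>
  define r where "r i x = card {y\<in>A. (y, x) \<in> S i \<and> y \<noteq> x}" for i x
  have r: "r i x < r i y" if "i \<in> {1..n}" "(x, y) \<in> S i" "x \<noteq> y" for i x y
  proof -
    have S': "trans (S i)" "antisym (S i)" "S i \<subseteq> A \<times> A"
      using S[OF that(1)] by (auto simp: order_on_defs)
    let ?L = "\<lambda>x. {z\<in>A. (z, x) \<in> S i \<and> z \<noteq> x}"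
    have "?L x \<subseteq> ?L y"
    proof
      fix z assume z: "z \<in> ?L x"
      then have "(z, y) \<in> S i" using transD[OF S'(1), of z x y] that by simp
      moreover have "z \<noteq> y" using z that antisymD[OF S'(2), of x y] by auto
      ultimately show "z \<in> ?L y" using z by simp
    qed
    moreover have "x \<in> ?L y - ?L x" using S'(3) that by blast
    ultimately have "?L x \<subset> ?L y" by blast
    then show ?thesis unfolding r_def using A by (intro psubset_card_mono) auto
  qed
  have "\<exists>y. cell a (\<lambda>i. r i x) y" for x
    by (rule realized_imp_cell[OF realized_all _ a, where h = "\<lambda>k. k"]) (simp add: mono_def)
  then obtain f where f: "\<And>x. cell a (\<lambda>i. r i x) (f x)" by metis
  have fM: "f x \<in> M" for x using f by (simp add: cell_def)
  have lt: "lt i (f x) (f y)" if i: "i \<in> {1..n}" and "(x, y) \<in> S i" "x \<noteq> y" for i x y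
  proof -
    have "lt i (f x) (a (Suc (r i x)))" "lt i (a (r i y)) (f y)"
      using f i by (auto simp: cell_def)
    then show ?thesis
      using chain_below[OF a i, of "f x" "Suc (r i x)" "r i y"] r[OF that]
        lt_trans[OF i, of "f x" "a (r i y)" "f y"] by simp
  qed
  have refl: "(x, x) \<in> S i" if "i \<in> {1..n}" "x \<in> A" for i x
    using S[OF that(1)] that(2) by (simp add: order_on_defs refl_on_def)
  have tot: "(x, y) \<in> S i \<or> (y, x) \<in> S i" if "i \<in> {1..n}" "x \<in> A" "y \<in> A" for i x y
    using S[OF that(1)] that refl[of i x] by (cases "x = y") (auto simp: order_on_defs total_on_def)
  have "inj_on f A"
  proof (rule inj_onI, rule ccontr)
    have 1: "1 \<in> {1..n}" using pos by simp
    fix x y assume "x \<in> A" "y \<in> A" and eq: "f x = f y" and neq: "x \<noteq> y"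
    then show False using tot[OF 1, of x y] lt[OF 1, of x y] lt[OF 1, of y x] by auto
  qed
  moreover have "(x, y) \<in> S i \<longleftrightarrow> (f x, f y) \<in> R i"
    if i: "i \<in> {1..n}" and xy: "x \<in> A" "y \<in> A" for i x y
  proof (cases "(x, y) \<in> S i")
    case True
    then have "x = y \<or> lt i (f x) (f y)" using lt[OF i] by blast
    then show ?thesis using True rel_iff_lt[OF i] fM by auto
  next
    case False
    then have "(y, x) \<in> S i" "y \<noteq> x" using tot[OF i xy] refl[OF i xy(1)] by auto
    then have "lt i (f y) (f x)" using lt[OF i] by blast
    then show ?thesis using False rel_iff_not_lt[OF i fM fM] by simp
  qed
  ultimately show ?thesis
    using fM by (intro exI[of _ f]) (auto simp: embedding_def)
qed

end

text \<open>This gives the inclusion of the age in the class of finite multiorders.\<close>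

lemma linear_order_on_pullback:
  assumes f: "embedding n A S M R f" and i: "i \<in> {1..n}" and R: "linear_order_on M (R i)"
    and S: "S i \<subseteq> A \<times> A"
  shows "linear_order_on A (S i)"
proof -
  have iff: "(x, y) \<in> S i \<longleftrightarrow> (f x, f y) \<in> R i" and fM: "f x \<in> M"
    and inj: "f x = f y \<longleftrightarrow> x = y" if "x \<in> A" "y \<in> A" for x y
    using f i that unfolding embedding_def by (auto dest: inj_onD)
  have R': "trans (R i)" "antisym (R i)" "refl_on M (R i)" "total_on M (R i)"
    using R by (auto simp: order_on_defs)
  have "refl_on A (S i)"
    using iff fM R'(3) by (simp add: refl_on_def)
  moreover have "trans (S i)"
  proof (rule transI)
    fix x y z assume xyz: "(x, y) \<in> S i" "(y, z) \<in> S i"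
    then have "x \<in> A" "y \<in> A" "z \<in> A" using S by auto
    then show "(x, z) \<in> S i" using xyz iff transD[OF R'(1), of "f x" "f y" "f z"] by simp
  qed
  moreover have "antisym (S i)"
  proof (rule antisymI)
    fix x y assume xy: "(x, y) \<in> S i" "(y, x) \<in> S i"
    then have "x \<in> A" "y \<in> A" using S by auto
    then show "x = y" using xy iff inj antisymD[OF R'(2), of "f x" "f y"] by simp
  qed
  moreover have "total_on A (S i)"
    using R'(4) iff fM inj unfolding total_on_def by simp
  ultimately show ?thesis using S by (simp add: order_on_defs)
qed

text \<open>Infinitude excludes degenerate structures such as a single point with one order, which
  meets the other hypotheses but has too small an age.\<close>

theorem theorem7p4:
  fixes M :: "'a set" and le :: "nat \<Rightarrow> 'a rel" and n :: nat
  assumes "countable M" and "infinite M"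
    and "\<And>i. i \<in> {1..n} \<Longrightarrow> linear_order_on M (le i)"
    and "homogeneous n M le"
    and "\<And>i j. i \<in> {1..n} \<Longrightarrow> j \<in> {1..n} \<Longrightarrow> i \<noteq> j \<Longrightarrow> le i \<noteq> le j \<and> le i \<noteq> (le j)\<inverse>"
    and "\<And>i. i \<in> {1..n} \<Longrightarrow> topologically_primitive n M le i"
  shows "fraisse_limit n M le (finite_multiorders n)"
proof -
  have embeds: "\<exists>f. embedding n A S M le f"
    if A: "finite A" and S: "\<And>i. i \<in> {1..n} \<Longrightarrow> linear_order_on A (S i)"
    for A :: "nat set" and S
  proof (cases "n = 0")
    \<comment> \<open>Without orders the structures are bare sets, and any injection into the
      infinite \<open>M\<close> is an embedding.\<close>
    case True
    obtain B where B: "B \<subseteq> M" "finite B" "card B = card A"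
      using infinite_arbitrarily_large[OF assms(2)] by blast
    then obtain f where "bij_betw f A B" using finite_same_card_bij[OF A] by metis
    then have "embedding n A S M le f"
      using True B by (auto simp: embedding_def bij_betw_def)
    then show ?thesis by blast
  next
    case False
    interpret homogeneous_orders n M le
      using assms False by unfold_locales auto
    obtain s where up: "\<And>x y. x \<in> M \<Longrightarrow> y \<in> M \<Longrightarrow>
        \<exists>z. homogeneous_orders.dominated n M (flip s le) x z \<and>
          homogeneous_orders.dominated n M (flip s le) y z"
      and down: "\<And>x y. x \<in> M \<Longrightarrow> y \<in> M \<Longrightarrow>
        \<exists>z. homogeneous_orders.dominated n M (flip s le) z x \<and>
          homogeneous_orders.dominated n M (flip s le) z y"
      using directed_signs by blast
    interpret flipped: homogeneous_orders n M "flip s le"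
      using assms False by unfold_locales auto
    interpret flipped: directed_orders n M "flip s le"
    proof
      fix i j assume "i \<in> {1..n}" "j \<in> {1..n}" "i \<noteq> j"
      \<comment> \<open>Equal signs require that the orders differ, unequal signs that they are not
        opposite.\<close>
      from assms(5)[OF this] show "flip s le i \<noteq> flip s le j"
        by (auto simp: flip_def)
    next
      show "topologically_primitive n M (flip s le) i" if "i \<in> {1..n}" for i
        by (rule topologically_primitive_flip) (rule assms(6)[OF that])
    qed (fact up, fact down)
    \<comment> \<open>Reversing the orders of \<open>A\<close> by the same signs makes the reversals
      cancel, so the map is an embedding for the original orders.\<close>
    have "\<exists>f. embedding n A (flip s S) M (flip s le) f"
      using A S by (intro flipped.embeds_finite_multiorder) auto
    then show ?thesis by simp
  qed
  have "age n M le = finite_multiorders n"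
  proof (intro set_eqI iffI)
    fix AS :: "nat set \<times> (nat \<Rightarrow> nat rel)"
    obtain A S where AS: "AS = (A, S)" by fastforce
    show "AS \<in> finite_multiorders n" if "AS \<in> age n M le"
    proof -
      from that obtain f where "finite A" "\<And>i. i \<in> {1..n} \<Longrightarrow> S i \<subseteq> A \<times> A" "embedding n A S M le f"
        by (auto simp: AS age_def)
      then show ?thesis
        using linear_order_on_pullback[of n A S M le f] assms(3)
        by (simp add: AS finite_multiorders_def)
    qed
    show "AS \<in> age n M le" if "AS \<in> finite_multiorders n"
      using that embeds[of A S] by (simp add: AS age_def finite_multiorders_def order_on_defs)
  qed
  with assms show ?thesis by (simp add: fraisse_limit_def)
qed

end
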